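(* Let $x,y,z,w,u,v$ be variables, regarded as complex numbers with $xv\neq zu$. Set $Q_0(x,y,z,w,u,v)=w$, let $\delta=\sqrt{xv-zu}$, $\hat\delta=\sqrt{zu-xv}$, and $$p=D_{\frac{zu-yw}{\delta^2}}\left(\frac{w-y}{\delta}\right),\quad q=D_{\frac{xv-yw}{\hat\delta^2}}\left(\frac{y-w}{\hat\delta}\right),\quad r=D_{\frac{xv-yw}{\delta^2}}\left(\frac{w-y}{\delta}\right),\quad s=D_{\frac{zu-yw}{\hat\delta^2}}\left(\frac{y-w}{\hat\delta}\right).$$ Then, as power series in $t$ (the right-hand side being expanded at $t=0$), $$\sum_{n=0}^\infty Q_n(x,y,z,w,u,v)\frac{t^n}{n!}=\frac{(\delta^2t+w-y)(pw-\delta r)\,D_{\frac{xv-yw}{\hat\delta^2}}\left(\hat\delta t+\frac{y-w}{\hat\delta}\right)}{(\hat\delta s-qy)D_{\frac{zu-yw}{\delta^2}}\left(\delta t+\frac{w-y}{\delta}\right)+(pw-\delta r)D_{\frac{xv-yw}{\hat\delta^2}}\left(\hat\delta t+\frac{y-w}{\hat\delta}\right)}$$ $$\qquad+\frac{\delta(\hat\delta s-qy)\,D_{\frac{xv-yw}{\delta^2}}\left(\delta t+\frac{w-y}{\delta}\right)+\hat\delta(pw-\delta r)\,D_{\frac{zu-yw}{\hat\delta^2}}\left(\hat\delta t+\frac{y-w}{\hat\delta}\right)}{(\hat\delta s-qy)D_{\frac{zu-yw}{\delta^2}}\left(\delta t+\frac{w-y}{\delta}\right)+(pw-\delta r)D_{\frac{xv-yw}{\hat\delta^2}}\left(\hat\delta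 t+\frac{y-w}{\hat\delta}\right)}.$$
   Context: Permutation statistics. For a permutation $\pi=\pi_1\cdots\pi_n$ of $[n]=\{1,\dots,n\}$ ($n\ge1$) put $\pi_0=\pi_{n+1}=0$. An index $1\le i\le n$ is a peak if $\pi_{i-1}<\pi_i>\pi_{i+1}$, a double rise if $\pi_{i-1}<\pi_i<\pi_{i+1}$, and a double descent if $\pi_{i-1}>\pi_i>\pi_{i+1}$. A peak $i$ is of pattern 132 if $\pi_{i-1}\le\pi_{i+1}$ (equality occurs only for $\pi=1$), and of pattern 231 if $\pi_{i-1}>\pi_{i+1}$. Let $p_1(\pi),p_2(\pi),dd(\pi),dr(\pi)$ be the numbers of peaks of pattern 132, peaks of pattern 231, double descents and double rises of $\pi$. For $n\ge1$, with $\mathfrak S_n$ the set of permutations of $[n]$, $$Q_n(x,y,z,w,u,v)=\sum_{\pi\in\mathfrak S_n}x^{p_1(\pi)}v^{p_1(\pi)}u^{p_2(\pi)}z^{p_2(\pi)}y^{dd(\pi)}w^{dr(\pi)}.$$ Parabolic cylinder functions. With $(a)_0=1$, $(a)_n=a(a+1)\cdots(a+n-1)$ and ${}_1F_1(a;b;z)=\sum_{n\ge0}\frac{(a)_n}{(b)_n}\frac{z^n}{n!}$, define $$D_a(z)=2^{a/2}\sqrt{\pi}\,e^{-z^2/4}\left(\frac{1}{\Gamma\left(\frac{1-a}{2}\right)}\,{}_1F_1\left(-\frac a2;\frac12;\frac{z^2}{2}\right)-\frac{\sqrt2\,z}{\Gamma\left(-\frac a2\right)}\,{}_1F_1\left(\frac{1-a}{2};\frac32;\frac{z^2}{2}\right)\right),$$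 where $1/\Gamma$ is the entire function (equal to $0$ at the poles of $\Gamma$). The square roots satisfy $\hat\delta=i\delta$. *)

theory Defs
  imports "HOL-Analysis.Analysis" "HOL-Combinatorics.Multiset_Permutations"
begin

text \<open>
  A permutation of \<open>[n]\<close> is given in one-line notation, as a list from
  \<^term>\<open>permutations_of_set {1..n}\<close>. Padding it with a \<open>0\<close> at both ends makes list index \<open>i\<close>
  agree with the usual 1-based index, with \<open>ext \<pi> 0 = ext \<pi> (length \<pi> + 1) = 0\<close>.
\<close>

definition ext :: "nat list \<Rightarrow> nat \<Rightarrow> nat" where
  "ext \<pi> i = (0 # \<pi> @ [0]) ! i"

definition is_peak :: "nat list \<Rightarrow> nat \<Rightarrow> bool" where
  "is_peak \<pi> i \<longleftrightarrow> ext \<pi> (i - 1) < ext \<pi> i \<and> ext \<pi> i > ext \<pi> (i + 1)"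

definition is_double_rise :: "nat list \<Rightarrow> nat \<Rightarrow> bool" where
  "is_double_rise \<pi> i \<longleftrightarrow> ext \<pi> (i - 1) < ext \<pi> i \<and> ext \<pi> i < ext \<pi> (i + 1)"

definition is_double_descent :: "nat list \<Rightarrow> nat \<Rightarrow> bool" where
  "is_double_descent \<pi> i \<longleftrightarrow> ext \<pi> (i - 1) > ext \<pi> i \<and> ext \<pi> i > ext \<pi> (i + 1)"

definition peaks132 :: "nat list \<Rightarrow> nat" where
  "peaks132 \<pi> = card {i \<in> {1..length \<pi>}. is_peak \<pi> i \<and> ext \<pi> (i - 1) \<le> ext \<pi> (i + 1)}"

definition peaks231 :: "nat list \<Rightarrow> nat" where
  "peaks231 \<pi> = card {i \<in> {1..length \<pi>}. is_peak \<pi> i \<and> ext \<pi> (i - 1) > ext \<pi> (i + 1)}"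

definition double_descents :: "nat list \<Rightarrow> nat" where
  "double_descents \<pi> = card {i \<in> {1..length \<pi>}. is_double_descent \<pi> i}"

definition double_rises :: "nat list \<Rightarrow> nat" where
  "double_rises \<pi> = card {i \<in> {1..length \<pi>}. is_double_rise \<pi> i}"

text \<open>The value \<open>w\<close> at \<open>n = 0\<close> is a convention; the sum over the empty permutation would give \<open>1\<close>.\<close>

definition Q ::
  "nat \<Rightarrow> complex \<Rightarrow> complex \<Rightarrow> complex \<Rightarrow> complex \<Rightarrow> complex \<Rightarrow> complex \<Rightarrow> complex" where
  "Q n x y z w u v =
     (if n = 0 then w
      else \<Sum>\<pi>\<in>permutations_of_set {1..n}.
        x ^ peaks132 \<pi> * v ^ peaks132 \<pi> * u ^ peaks231 \<pi> * z ^ peaks231 \<pi> *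
        y ^ double_descents \<pi> * w ^ double_rises \<pi>)"

definition hyp1F1 :: "complex \<Rightarrow> complex \<Rightarrow> complex \<Rightarrow> complex" where
  "hyp1F1 a b z = (\<Sum>n. pochhammer a n / pochhammer b n * (z ^ n / fact n))"

text \<open>
  The parabolic cylinder function \<open>D\<^sub>a(z)\<close>. The library function \<^const>\<open>rGamma\<close> is the entire
  function \<open>1/\<Gamma>\<close>, and \<open>2 powr (a/2)\<close> is \<open>exp (a/2 * ln 2)\<close> with the real logarithm of \<open>2\<close>.
\<close>

definition parcyl :: "complex \<Rightarrow> complex \<Rightarrow> complex" where
  "parcyl a z =
     2 powr (a / 2) * of_real (sqrt pi) * exp (- (z ^ 2) / 4) *
     (rGamma ((1 - a) / 2) * hyp1F1 (- a / 2) (1 / 2) (z ^ 2 / 2)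
      - of_real (sqrt 2) * z * rGamma (- a / 2) * hyp1F1 ((1 - a) / 2) (3 / 2) (z ^ 2 / 2))"

end

theory Submission
  imports Defs "HOL-Complex_Analysis.Complex_Analysis"
begin

text \<open>
  Put \<open>a = xv\<close> and \<open>b = zu\<close>, and let \<open>G(t)\<close> be the exponential generating function on the right of
  the expansion. Both sides are identified through one Riccati equation.

  \<^bold>\<open>Combinatorial side.\<close> Cut a nonempty permutation at its entry \<open>1\<close>, as \<open>\<sigma> 1 \<tau>\<close>. Since \<open>1\<close> is smaller
  than all its neighbours except the padding zeros, it is a peak, a double rise, a double descent or
  a valley according to which of \<open>\<sigma>\<close>, \<open>\<tau>\<close> are empty, and the other entries only see their own block,
  now padded by \<open>0, 1\<close> on the two sides of \<open>\<sigma>\<close> and by \<open>1, 0\<close> on those of \<open>\<tau>\<close>. The unequal padding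
  matters only for a block of length one: a single entry is a peak of pattern 132 between \<open>0\<close> and \<open>1\<close>, but of
  pattern 231 between \<open>1\<close> and \<open>0\<close>, so that \<open>\<tau>\<close> contributes \<open>b\<close> instead of \<open>a\<close>. With the
  convention \<open>Q\<^sub>0 = w\<close> this gives (\<open>perm_egf_riccati\<close>)
  \<open>G' = G (G + y - w - (a - b) t) + a - yw\<close> and \<open>G(0) = w\<close>.

  \<^bold>\<open>Analytic side.\<close> A Riccati equation is linearised by \<open>G = -\<phi>'/\<phi>\<close>. In the variable
  \<open>X = \<delta>t + (w - y)/\<delta>\<close> the linear equation is that of \<open>exp (-X\<^sup>2/4)\<close> times a parabolic cylinder
  function of index \<open>\<nu> = (b - yw)/\<delta>\<^sup>2\<close>, with the two solutions \<open>D\<^sub>\<nu>(X)\<close> and \<open>D\<^sub>-\<^sub>\<nu>\<^sub>-\<^sub>1(\<i>X)\<close>. What is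
  needed about derivatives are the two ladder relations \<open>D\<^sub>a' = (z/2) D\<^sub>a - D\<^sub>a\<^sub>+\<^sub>1\<close> and \<open>D\<^sub>a\<^sub>+\<^sub>1' = (a+1) D\<^sub>a - (z/2) D\<^sub>a\<^sub>+\<^sub>1\<close>
  (\<open>parcyl_deriv_raise\<close>, \<open>parcyl_deriv_lower\<close>), which come from contiguous relations of \<open>\<^sub>1F\<^sub>1\<close>.
  The coefficients \<open>\<delta>'s - qy\<close> and \<open>pw - \<delta>r\<close> are chosen such that the quotient takes the value \<open>w\<close> at
  \<open>t = 0\<close>. With them the denominator at \<open>t = 0\<close> is, up to sign, \<open>\<delta>\<close> times the Wronskian of the two
  solutions, which \<open>parcyl_wronskian\<close> evaluates to a number that never vanishes, by the reflection
  formula for \<open>\<Gamma>\<close>.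

  A power series solution of the Riccati equation is determined by its constant term
  (\<open>riccati_fps_unique\<close>), so the two sides agree.
\<close>

section \<open>Sums over permutations and subsets\<close>

text \<open>
  A list containing \<open>m\<close> exactly once is cut in a unique way at \<open>m\<close>; \<open>T\<close> is the set of entries to the
  left of \<open>m\<close>.
\<close>

lemma permutations_of_set_split_at:
  assumes "finite S" "m \<notin> S"
  shows "(\<Sum>\<pi>\<in>permutations_of_set (insert m S). F \<pi>) =
    (\<Sum>T\<in>Pow S. \<Sum>\<sigma>\<in>permutations_of_set T. \<Sum>\<tau>\<in>permutations_of_set (S - T). F (\<sigma> @ m # \<tau>))"
    (is "_ = ?rhs")
proof -
  define I where "I = (SIGMA T:Pow S. permutations_of_set T \<times> permutations_of_set (S - T))"
  have finT: "finite T" if "T \<in> Pow S" for T using that assms finite_subset by auto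
  have bij: "bij_betw (\<lambda>(T, \<sigma>, \<tau>). \<sigma> @ m # \<tau>) I (permutations_of_set (insert m S))"
    unfolding bij_betw_def
  proof
    show "inj_on (\<lambda>(T, \<sigma>, \<tau>). \<sigma> @ m # \<tau>) I"
    proof (rule inj_onI)
      fix t t'
      assume tI: "t \<in> I" "t' \<in> I"
        and eq: "(\<lambda>(T, \<sigma>, \<tau>). \<sigma> @ m # \<tau>) t = (\<lambda>(T, \<sigma>, \<tau>). \<sigma> @ m # \<tau>) t'"
      obtain T \<sigma> \<tau> T' \<sigma>' \<tau>' where t: "t = (T, \<sigma>, \<tau>)" "t' = (T', \<sigma>', \<tau>')"
        by (metis prod_cases3)
      have "m \<notin> set \<sigma>" "set \<sigma> = T" "set \<sigma>' = T'" "m \<notin> set \<tau>"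
        using tI assms(2) by (auto simp: t I_def permutations_of_set_def)
      then show "t = t'"
        using eq by (auto simp: t append_Cons_eq_iff)
    qed
    show "(\<lambda>(T, \<sigma>, \<tau>). \<sigma> @ m # \<tau>) ` I = permutations_of_set (insert m S)"
    proof (intro set_eqI iffI)
      fix \<pi> assume "\<pi> \<in> (\<lambda>(T, \<sigma>, \<tau>). \<sigma> @ m # \<tau>) ` I"
      then show "\<pi> \<in> permutations_of_set (insert m S)"
        using assms(2) by (auto simp: I_def permutations_of_set_def)
    next
      fix \<pi> assume \<pi>: "\<pi> \<in> permutations_of_set (insert m S)"
      then have "m \<in> set \<pi>" by (auto simp: permutations_of_set_def)
      then obtain \<sigma> \<tau> where eq: "\<pi> = \<sigma> @ m # \<tau>" by (meson split_list)
      have "distinct \<pi>" "set \<pi> = insert m S" using \<pi> by (auto simp: permutations_of_set_def)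
      then have "(set \<sigma>, \<sigma>, \<tau>) \<in> I"
        using eq assms(2) by (auto simp: I_def permutations_of_set_def)
      then show "\<pi> \<in> (\<lambda>(T, \<sigma>, \<tau>). \<sigma> @ m # \<tau>) ` I"
        using eq by (auto intro!: rev_image_eqI)
    qed
  qed
  have "?rhs = (\<Sum>(T, \<sigma>, \<tau>)\<in>I. F (\<sigma> @ m # \<tau>))"
    unfolding I_def using assms finT
    by (subst sum.Sigma[symmetric]) (auto simp: sum.cartesian_product finite_subset)
  also have "\<dots> = (\<Sum>t\<in>I. F ((\<lambda>(T, \<sigma>, \<tau>). \<sigma> @ m # \<tau>) t))"
    by (intro sum.cong) auto
  also have "\<dots> = (\<Sum>\<pi>\<in>permutations_of_set (insert m S). F \<pi>)"
    by (rule sum.reindex_bij_betw[OF bij])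
  finally show ?thesis by simp
qed

lemma sum_Pow_card:
  fixes f :: "nat \<Rightarrow> 'a :: comm_semiring_1"
  assumes "finite S"
  shows "(\<Sum>T\<in>Pow S. f (card T)) = (\<Sum>k\<le>card S. of_nat (card S choose k) * f k)"
proof -
  have "(\<Sum>T\<in>Pow S. f (card T)) = (\<Sum>k\<le>card S. \<Sum>T | T \<in> Pow S \<and> card T = k. f (card T))"
    using assms by (intro sum.group[symmetric]) (auto intro: card_mono)
  also have "\<dots> = (\<Sum>k\<le>card S. of_nat (card S choose k) * f k)"
    using n_subsets[OF assms] by (intro sum.cong) auto
  finally show ?thesis .
qed

lemma power_card_filter:
  fixes c :: "'a :: comm_monoid_mult"
  shows "finite A \<Longrightarrow> c ^ card {i \<in> A. P i} = (\<Prod>i\<in>A. if P i then c else 1)"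
  by (simp add: prod.inter_filter[symmetric])

section \<open>Weights of padded permutations\<close>

context
  fixes a b w y :: "'a :: field_char_0"
begin

text \<open>
  The factor that the middle one of three consecutive entries contributes: \<open>a\<close> and \<open>b\<close> for peaks of
  pattern 132 and 231, \<open>w\<close> for double rises, \<open>y\<close> for double descents, and \<open>1\<close> for valleys. As in
  the statistic itself, a peak between equal letters counts as 132.
\<close>

definition triple_weight :: "nat \<Rightarrow> nat \<Rightarrow> nat \<Rightarrow> 'a" where
  "triple_weight l m r =
     (if l < m \<and> r < m then (if r < l then b else a)
      else if l < m \<and> m < r then w
      else if m < l \<and> r < m then y
      else 1)"

text \<open>
  The two outermost letters serve only as neighbours and contribute no factor of their own.
\<close>

definition path_weight :: "nat list \<Rightarrow> 'a" where
  "path_weight xs = (\<Prod>i<length xs - 2. triple_weight (xs ! i) (xs ! (i + 1)) (xs ! (i + 2)))"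

lemma path_weight_pair [simp]: "path_weight [l, m] = 1"
  by (simp add: path_weight_def)

lemma path_weight_Cons:
  "path_weight (l # m # r # xs) = triple_weight l m r * path_weight (m # r # xs)"
  by (simp add: path_weight_def prod.lessThan_Suc_shift del: prod.lessThan_Suc)

text \<open>
  Cutting between \<open>l\<close> and \<open>m\<close> leaves each of them with both neighbours in exactly one of the parts, so the
  two parts have to overlap in these two letters.
\<close>

lemma path_weight_append:
  "path_weight (xs @ l # m # ys) = path_weight (xs @ [l, m]) * path_weight (l # m # ys)"
proof (induction xs)
  case (Cons x xs)
  show ?case
  proof (cases xs)
    case (Cons x' xs')
    then show ?thesis using Cons.IH
      by (cases xs') (auto simp: path_weight_Cons)
  qed (simp add: path_weight_Cons)
qed simp

text \<open>
  A weight depends on the relative order of entries at distance at most two. At distance two only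
  the strict comparison from right to left is read off; this is the asymmetry that lets the padding
  \<open>0, 0\<close> be exchanged for any \<open>l \<le> r\<close> but not for \<open>l > r\<close>.
\<close>

lemma path_weight_cong:
  assumes "length xs = length ys"
    and "\<And>i. i + 2 < length xs \<Longrightarrow> xs ! i < xs ! (i + 1) \<longleftrightarrow> ys ! i < ys ! (i + 1)"
    and "\<And>i. i + 2 < length xs \<Longrightarrow> xs ! (i + 1) < xs ! i \<longleftrightarrow> ys ! (i + 1) < ys ! i"
    and "\<And>i. i + 2 < length xs \<Longrightarrow> xs ! (i + 1) < xs ! (i + 2) \<longleftrightarrow> ys ! (i + 1) < ys ! (i + 2)"
    and "\<And>i. i + 2 < length xs \<Longrightarrow> xs ! (i + 2) < xs ! (i + 1) \<longleftrightarrow> ys ! (i + 2) < ys ! (i + 1)"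
    and "\<And>i. i + 2 < length xs \<Longrightarrow> xs ! (i + 2) < xs ! i \<longleftrightarrow> ys ! (i + 2) < ys ! i"
  shows "path_weight xs = path_weight ys"
proof -
  have "triple_weight (xs ! i) (xs ! (i + 1)) (xs ! (i + 2)) =
        triple_weight (ys ! i) (ys ! (i + 1)) (ys ! (i + 2))" if "i < length xs - 2" for i
    using assms(2-6)[of i] that by (simp add: triple_weight_def)
  then show ?thesis
    unfolding path_weight_def assms(1)[symmetric] by (intro prod.cong) auto
qed

definition arrangement_sum :: "nat set \<Rightarrow> nat \<Rightarrow> nat \<Rightarrow> 'a" where
  "arrangement_sum S l r = (\<Sum>\<pi>\<in>permutations_of_set S. path_weight (l # \<pi> @ [r]))"

lemma arrangement_sum_empty [simp]: "arrangement_sum {} l r = 1"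
  by (simp add: arrangement_sum_def)

text \<open>
  The order isomorphism between \<open>{1..n}\<close> and \<open>S\<close> preserves all comparisons of entries, and paddings
  below \<open>S\<close> behave towards the entries like \<open>0\<close>. The two paddings are compared with each other only
  when they are at distance two, that is for \<open>n = 1\<close>.
\<close>

lemma arrangement_sum_relabel:
  assumes fin: "finite S" and card: "card S = n"
    and below: "\<And>s. s \<in> S \<Longrightarrow> l < s \<and> r < s" and bd: "n = 1 \<Longrightarrow> l \<le> r"
  shows "arrangement_sum S l r = arrangement_sum {1..n} 0 0"
proof -
  obtain h where h: "bij_betw h {..<card S} S" "strict_mono_on {..<card S} h"
    using ex_bij_betw_strict_mono_card[OF fin] .
  define f where "f = (\<lambda>i. h (i - 1))"
  have img: "f ` {1..n} = S"
  proof -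
    have "(\<lambda>i. i - 1) ` {1..n} = {..<n}"
    proof (intro set_eqI iffI)
      fix j assume "j \<in> {..<n}"
      then show "j \<in> (\<lambda>i. i - 1) ` {1..n}" by (intro image_eqI[of _ _ "Suc j"]) auto
    qed auto
    moreover have "f ` {1..n} = h ` (\<lambda>i. i - 1) ` {1..n}" unfolding f_def image_image ..
    ultimately have "f ` {1..n} = h ` {..<n}" by (simp only:)
    then show ?thesis using bij_betw_imp_surj_on[OF h(1)] card by simp
  qed
  have mono: "f i < f j \<longleftrightarrow> i < j" if "i \<in> {1..n}" "j \<in> {1..n}" for i j
  proof -
    have "i - 1 \<in> {..<card S}" "j - 1 \<in> {..<card S}" using that card by auto
    then have "h (i - 1) < h (j - 1) \<longleftrightarrow> i - 1 < j - 1"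
      using h(2) by (metis linorder_less_linear order_less_asym strict_mono_onD)
    then show ?thesis using that by (auto simp: f_def)
  qed
  have inj: "inj_on f {1..n}"
  proof (rule linorder_inj_onI)
    show "f i \<noteq> f j" if "i < j" "i \<in> {1..n}" "j \<in> {1..n}" for i j
      using mono[of i j] that by simp
  qed auto
  have "path_weight (l # map f \<pi> @ [r]) = path_weight (0 # \<pi> @ [0])"
    if "\<pi> \<in> permutations_of_set {1..n}" for \<pi>
  proof -
    have set: "set \<pi> = {1..n}" and len: "length \<pi> = n"
      using that by (auto simp: permutations_of_set_def dest: distinct_card)
    (* Comparisons of X and Y can only differ if both positions carry a padding letter. *)
    define X where "X = l # map f \<pi> @ [r]"
    define Y where "Y = 0 # \<pi> @ [0]"
    have inner: "X ! i = f (Y ! i) \<and> Y ! i \<in> {1..n} \<and> l < X ! i \<and> r < X ! i"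
      if "1 \<le> i" "i \<le> n" for i
    proof -
      have "Y ! i = \<pi> ! (i - 1)" "X ! i = f (\<pi> ! (i - 1))"
        using that len by (auto simp: X_def Y_def nth_append nth_Cons' split: if_splits)
      moreover have "\<pi> ! (i - 1) \<in> {1..n}"
        using that len set nth_mem by (metis Suc_pred' less_eq_Suc_le less_le_trans zero_less_one)
      ultimately show ?thesis using below img by auto
    qed
    have ends: "X ! 0 = l" "Y ! 0 = 0" "X ! (n + 1) = r" "Y ! (n + 1) = 0"
      using len by (auto simp: X_def Y_def nth_append)
    have lens: "length X = n + 2" "length Y = n + 2" using len by (auto simp: X_def Y_def)
    have cmp: "X ! i < X ! j \<longleftrightarrow> Y ! i < Y ! j"
      if ij: "i \<le> n + 1" "j \<le> n + 1" and ne: "i \<in> {1..n} \<or> j \<in> {1..n}" for i j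
    proof -
      have "i = 0 \<or> i \<in> {1..n} \<or> i = n + 1" "j = 0 \<or> j \<in> {1..n} \<or> j = n + 1"
        using ij by auto
      then show ?thesis
        using ne inner[of i] inner[of j] mono[of "Y ! i" "Y ! j"] ends
        by (auto simp del: One_nat_def)
    qed
    have "path_weight X = path_weight Y"
    proof (rule path_weight_cong)
      show "X ! (i + 2) < X ! i \<longleftrightarrow> Y ! (i + 2) < Y ! i" if "i + 2 < length X" for i
      proof (cases "n = 1")
        case True
        then have "i = 0" using that lens by simp
        then show ?thesis using ends bd True by (simp add: numeral_2_eq_2)
      next
        case False
        then show ?thesis using that lens by (intro cmp) auto
      qed
    qed ((rule cmp, auto simp: lens)[1] | simp add: lens)+
    then show ?thesis by (simp add: X_def Y_def)
  qed
  moreover have "arrangement_sum S l r =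
      (\<Sum>\<pi>\<in>permutations_of_set {1..n}. path_weight (l # map f \<pi> @ [r]))"
    unfolding arrangement_sum_def
    unfolding img[symmetric] permutations_of_set_image_inj[OF inj]
  proof (subst sum.reindex)
    show "inj_on (map f) (permutations_of_set {1..n})"
      using inj by (intro inj_onI, subst (asm) inj_on_map_eq_map)
        (auto simp: permutations_of_set_def)
  qed simp
  ultimately show ?thesis by (simp add: arrangement_sum_def)
qed

lemma arrangement_sum_single:
  "l < m \<Longrightarrow> r < m \<Longrightarrow> arrangement_sum {m} l r = (if r < l then b else a)"
  by (simp add: arrangement_sum_def path_weight_Cons triple_weight_def)

section \<open>The recurrence from the position of the smallest entry\<close>

text \<open>The polynomial \<open>Q\<^sub>n\<close>, in terms of \<open>a = xv\<close> and \<open>b = zu\<close>.\<close>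

definition perm_sum :: "nat \<Rightarrow> 'a" where
  "perm_sum n = (if n = 0 then w else arrangement_sum {1..n} 0 0)"

lemma triple_weight_at_minimum:
  assumes "\<forall>s\<in>set \<sigma> \<union> set \<tau>. 1 < s"
  shows "triple_weight (last (0 # \<sigma>)) 1 (hd (\<tau> @ [0])) =
    (if \<sigma> = [] \<and> \<tau> = [] then a else if \<sigma> = [] then w else if \<tau> = [] then y else 1)"
proof -
  have "1 < last \<sigma>" if "\<sigma> \<noteq> []" using assms that by auto
  moreover have "1 < hd \<tau>" if "\<tau> \<noteq> []" using assms that by auto
  ultimately show ?thesis by (auto simp: triple_weight_def hd_append)
qed

lemma path_weight_at_minimum:
  "path_weight (0 # \<sigma> @ 1 # \<tau> @ [0]) = path_weight (0 # \<sigma> @ [1]) *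
     triple_weight (last (0 # \<sigma>)) 1 (hd (\<tau> @ [0])) * path_weight (1 # \<tau> @ [0])"
proof -
  obtain \<sigma>' l where 1: "0 # \<sigma> = \<sigma>' @ [l]" by (metis append_butlast_last_id list.distinct(1))
  obtain r \<tau>' where 2: "\<tau> @ [0] = r # \<tau>'" by (metis append_is_Nil_conv list.exhaust list.distinct(1))
  have "path_weight (0 # \<sigma> @ 1 # \<tau> @ [0]) = path_weight (\<sigma>' @ l # 1 # r # \<tau>')"
    using 1 2 by (metis append.assoc append_Cons append_Nil)
  also have "\<dots> = path_weight (\<sigma>' @ [l, 1]) * (triple_weight l 1 r * path_weight (1 # r # \<tau>'))"
    by (subst path_weight_append) (simp add: path_weight_Cons)
  also have "\<sigma>' @ [l, 1] = 0 # \<sigma> @ [1]" using 1 by (metis append.assoc append_Cons append_Nil)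
  also have "l = last (0 # \<sigma>)" using 1 by (metis last_snoc)
  also have "r = hd (\<tau> @ [0])" using 2 by simp
  finally show ?thesis using 2 by (simp add: mult.assoc)
qed

lemma arrangement_sum_left: 
  assumes "finite T" "\<forall>s\<in>T. 1 < s" "T \<noteq> {}"
  shows "arrangement_sum T 0 1 = perm_sum (card T)"
proof -
  have "arrangement_sum T 0 1 = arrangement_sum {1..card T} 0 0"
    using assms by (intro arrangement_sum_relabel) auto
  then show ?thesis using assms by (simp add: perm_sum_def)
qed

text \<open>
  The contribution of the block \<open>\<tau>\<close> to the right of the entry \<open>1\<close>. A block of length one sits between
  \<open>1\<close> and \<open>0\<close>, so its peak weighs \<open>b\<close> instead of \<open>a\<close>; an empty block makes \<open>1\<close> a double descent if there is
  an entry to its left, which is recorded by the value \<open>y\<close> at \<open>0\<close>. In the same way the value \<open>w\<close> of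
  \<open>Q\<^sub>0\<close> records the double rise caused by an empty left block.
\<close>

definition right_block_sum :: "nat \<Rightarrow> 'a" where
  "right_block_sum j = perm_sum j - (if j = 1 then a - b else 0) + (if j = 0 then y - w else 0)"

lemma arrangement_sum_right:
  assumes "finite T" "\<forall>s\<in>T. 1 < s" "T \<noteq> {}"
  shows "arrangement_sum T 1 0 = right_block_sum (card T)"
proof (cases "card T = 1")
  case True
  then obtain m where "T = {m}" by (meson card_1_singletonE)
  then show ?thesis using assms by (simp add: arrangement_sum_single perm_sum_def right_block_sum_def)
next
  case False
  have "arrangement_sum T 1 0 = arrangement_sum {1..card T} 0 0"
    using assms False by (intro arrangement_sum_relabel) auto
  then show ?thesis using assms False by (simp add: perm_sum_def right_block_sum_def)
qed

text \<open>
  The entries \<open>2, ..., n + 1\<close> are distributed to the two sides of \<open>1\<close>. The product of the values at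
  empty blocks describes the position of \<open>1\<close> correctly unless both blocks are empty: then \<open>1\<close> is a
  peak of weight \<open>a\<close> and not \<open>wy\<close>, whence the correction for \<open>n = 0\<close>.
\<close>

lemma perm_sum_Suc:
  "perm_sum (Suc n) = (\<Sum>k\<le>n. of_nat (n choose k) * (perm_sum k * right_block_sum (n - k)))
     + (if n = 0 then a - y * w else 0)"
proof -
  define S where "S = {2..Suc n}"
  have S: "finite S" "card S = n" "1 \<notin> S" "{1..Suc n} = insert 1 S" "\<forall>s\<in>S. 1 < s"
    by (auto simp: S_def)
  have "perm_sum (Suc n) = (\<Sum>T\<in>Pow S. \<Sum>\<sigma>\<in>permutations_of_set T. \<Sum>\<tau>\<in>permutations_of_set (S - T).
          path_weight (0 # \<sigma> @ 1 # \<tau> @ [0]))"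
    unfolding perm_sum_def arrangement_sum_def S(4)
    by (simp add: permutations_of_set_split_at[OF S(1,3)] del: One_nat_def)
  also have "\<dots> = (\<Sum>T\<in>Pow S. perm_sum (card T) * right_block_sum (n - card T) + (if n = 0 then a - y * w else 0))"
  proof (intro sum.cong refl)
    fix T assume T: "T \<in> Pow S"
    (* The weight of the entry 1 itself. *)
    define c where "c = (if T = {} \<and> S - T = {} then a else if T = {} then w else if S - T = {} then y else 1)"
    have T': "finite T" "\<forall>s\<in>T. 1 < s" "finite (S - T)" "\<forall>s\<in>S - T. 1 < s"
      "card (S - T) = n - card T"
      using T S by (auto simp: finite_subset card_Diff_subset)
    have "(\<Sum>\<sigma>\<in>permutations_of_set T. \<Sum>\<tau>\<in>permutations_of_set (S - T).
          path_weight (0 # \<sigma> @ 1 # \<tau> @ [0])) =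
        (\<Sum>\<sigma>\<in>permutations_of_set T. \<Sum>\<tau>\<in>permutations_of_set (S - T).
          path_weight (0 # \<sigma> @ [1]) * c * path_weight (1 # \<tau> @ [0]))"
    proof (intro sum.cong refl)
      fix \<sigma> \<tau> assume st: "\<sigma> \<in> permutations_of_set T" "\<tau> \<in> permutations_of_set (S - T)"
      then have set: "set \<sigma> = T" "set \<tau> = S - T" by (auto simp: permutations_of_set_def)
      then have "T = {} \<longleftrightarrow> \<sigma> = []" "S - T = {} \<longleftrightarrow> \<tau> = []"
        by (metis set_empty)+
      then have c: "c = (if \<sigma> = [] \<and> \<tau> = [] then a else if \<sigma> = [] then w else if \<tau> = [] then y else 1)"
        by (simp only: c_def)
      have "\<forall>s\<in>set \<sigma> \<union> set \<tau>. 1 < s" using T'(2,4) unfolding set by blast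
      then have "triple_weight (last (0 # \<sigma>)) 1 (hd (\<tau> @ [0])) = c"
        unfolding c by (rule triple_weight_at_minimum)
      then show "path_weight (0 # \<sigma> @ 1 # \<tau> @ [0]) =
          path_weight (0 # \<sigma> @ [1]) * c * path_weight (1 # \<tau> @ [0])"
        by (simp only: path_weight_at_minimum)
    qed
    also have "\<dots> = arrangement_sum T 0 1 * c * arrangement_sum (S - T) 1 0"
      by (simp only: arrangement_sum_def sum_distrib_right) (simp only: sum_distrib_left)
    also have "\<dots> = perm_sum (card T) * right_block_sum (n - card T) + (if n = 0 then a - y * w else 0)"
    proof -
      define U where "U = S - T"
      have "n = 0 \<longleftrightarrow> T = {} \<and> U = {}" using S T by (auto simp: U_def)
      moreover have "finite U" using T' by (simp add: U_def)
      moreover have "arrangement_sum T 0 1 = perm_sum (card T)" if "T \<noteq> {}"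
        using that T' by (intro arrangement_sum_left)
      moreover have "arrangement_sum U 1 0 = right_block_sum (card U)" if "U \<noteq> {}"
        using that T'(3,4) unfolding U_def by (intro arrangement_sum_right)
      moreover have "right_block_sum 0 = y" "perm_sum 0 = w" by (simp_all add: right_block_sum_def perm_sum_def)
      ultimately show ?thesis
        unfolding c_def T'(5)[symmetric] U_def[symmetric]
        by (cases "T = {}"; cases "U = {}") simp_all
    qed
    finally show "(\<Sum>\<sigma>\<in>permutations_of_set T. \<Sum>\<tau>\<in>permutations_of_set (S - T).
          path_weight (0 # \<sigma> @ 1 # \<tau> @ [0])) =
        perm_sum (card T) * right_block_sum (n - card T) + (if n = 0 then a - y * w else 0)" .
  qed
  also have "\<dots> = (\<Sum>T\<in>Pow S. perm_sum (card T) * right_block_sum (n - card T)) + (if n = 0 then a - y * w else 0)"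
    using S by (auto simp: sum.distrib S_def)
  also have "(\<Sum>T\<in>Pow S. perm_sum (card T) * right_block_sum (n - card T)) =
      (\<Sum>k\<le>n. of_nat (n choose k) * (perm_sum k * right_block_sum (n - k)))"
    using sum_Pow_card[OF S(1), of "\<lambda>k. perm_sum k * right_block_sum (n - k)"] S(2) by simp
  finally show ?thesis .
qed

definition perm_egf :: "'a fps" where "perm_egf = Abs_fps (\<lambda>n. perm_sum n / fact n)"

lemma perm_egf_riccati:
  "fps_deriv perm_egf = perm_egf * (perm_egf + fps_const (y - w) - fps_const (a - b) * fps_X)
     + fps_const (a - y * w)"
proof (rule fps_ext)
  fix n
  define H where "H = perm_egf + fps_const (y - w) - fps_const (a - b) * fps_X"
  have H: "fps_nth H j = right_block_sum j / fact j" for j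
    unfolding H_def
    by (cases j) (auto simp: perm_egf_def right_block_sum_def add_divide_distrib diff_divide_distrib)
  have "fps_nth (fps_deriv perm_egf) n = perm_sum (Suc n) / fact n"
    by (simp add: perm_egf_def field_simps del: of_nat_Suc)
  also have "\<dots> = (\<Sum>k\<le>n. (perm_sum k / fact k) * (right_block_sum (n - k) / fact (n - k)))
      + (if n = 0 then a - y * w else 0)"
    by (auto simp: perm_sum_Suc add_divide_distrib sum_divide_distrib binomial_fact intro!: sum.cong)
  also have "\<dots> = fps_nth (perm_egf * H + fps_const (a - y * w)) n"
    by (simp add: fps_mult_nth H atMost_atLeast0) (simp add: perm_egf_def)
  finally show "fps_nth (fps_deriv perm_egf) n =
      fps_nth (perm_egf * (perm_egf + fps_const (y - w) - fps_const (a - b) * fps_X)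
        + fps_const (a - y * w)) n"
    unfolding H_def .
qed

end

lemma Q_eq_perm_sum: "Q n x y z w u v = perm_sum (x * v) (z * u) w y n"
proof (cases "n = 0")
  case False
  have "x ^ peaks132 \<pi> * v ^ peaks132 \<pi> * u ^ peaks231 \<pi> * z ^ peaks231 \<pi> *
        y ^ double_descents \<pi> * w ^ double_rises \<pi> = path_weight (x * v) (z * u) w y (0 # \<pi> @ [0])"
    for \<pi>
  proof -
    have "x ^ peaks132 \<pi> * v ^ peaks132 \<pi> * u ^ peaks231 \<pi> * z ^ peaks231 \<pi> *
        y ^ double_descents \<pi> * w ^ double_rises \<pi> =
        (x * v) ^ peaks132 \<pi> * (z * u) ^ peaks231 \<pi> * y ^ double_descents \<pi> * w ^ double_rises \<pi>"
      by (simp add: power_mult_distrib mult_ac)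
    also have "\<dots> = (\<Prod>i\<in>{1..length \<pi>}.
        triple_weight (x * v) (z * u) w y (ext \<pi> (i - 1)) (ext \<pi> i) (ext \<pi> (i + 1)))"
      unfolding peaks132_def peaks231_def double_descents_def double_rises_def
        power_card_filter[OF finite_atLeastAtMost] prod.distrib[symmetric]
      by (intro prod.cong refl)
         (auto simp: triple_weight_def is_peak_def is_double_rise_def is_double_descent_def)
    also have "\<dots> = (\<Prod>i<length \<pi>.
        triple_weight (x * v) (z * u) w y (ext \<pi> i) (ext \<pi> (i + 1)) (ext \<pi> (i + 2)))"
      by (rule prod.reindex_bij_witness[of _ Suc "\<lambda>i. i - 1"]) auto
    also have "\<dots> = path_weight (x * v) (z * u) w y (0 # \<pi> @ [0])"
      by (simp add: path_weight_def ext_def)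
    finally show ?thesis .
  qed
  then show ?thesis using False by (simp add: Q_def perm_sum_def arrangement_sum_def)
qed (simp add: Q_def perm_sum_def)

section \<open>Kummer's confluent hypergeometric series\<close>

definition kummer_fps :: "complex \<Rightarrow> complex \<Rightarrow> complex fps" where
  "kummer_fps a b = Abs_fps (\<lambda>n. pochhammer a n / (pochhammer b n * fact n))"

text \<open>
  The quotient of consecutive terms is \<open>(a + n) z / ((b + n) (n + 1))\<close>, which tends to \<open>0\<close>. The ratio test
  is applied as an inequality, because the numerator may vanish when the series is a polynomial.
\<close>

lemma fps_conv_radius_kummer [simp]:
  assumes b: "\<And>n. b + of_nat n \<noteq> 0"
  shows "fps_conv_radius (kummer_fps a b) = \<infinity>"
  unfolding fps_conv_radius_def
proof (rule conv_radius_inftyI'')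
  fix z :: complex
  define f where "f = (\<lambda>n. fps_nth (kummer_fps a b) n * z ^ n)"
  define g where "g = (\<lambda>n::nat. norm ((a + of_nat n) / ((b + of_nat n) * of_nat (Suc n)) * z))"
  have f_Suc: "norm (f (Suc n)) = g n * norm (f n)" for n
    unfolding norm_mult[symmetric] g_def f_def
    by (simp add: kummer_fps_def pochhammer_Suc field_simps norm_mult norm_divide del: of_nat_Suc)
  have "g \<longlonglongrightarrow> 0"
  proof -
    have "(\<lambda>n. (a / of_nat n + 1) / (b / of_nat n + 1) * inverse (of_nat (Suc n)) * z) \<longlonglongrightarrow> (0 + 1) / (0 + 1) * 0 * z"
      by (intro tendsto_intros lim_const_over_n LIMSEQ_Suc[OF lim_inverse_n]) auto
    moreover have "\<forall>\<^sub>F n in sequentially. (a / of_nat n + 1) / (b / of_nat n + 1) * inverse (of_nat (Suc n)) * z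
       = (a + of_nat n) / ((b + of_nat n) * of_nat (Suc n)) * z"
      using eventually_gt_at_top[of 0]
    proof eventually_elim
      case (elim n)
      then show ?case using b[of n] by (simp add: divide_simps del: of_nat_Suc)
    qed
    ultimately have "(\<lambda>n. (a + of_nat n) / ((b + of_nat n) * of_nat (Suc n)) * z) \<longlonglongrightarrow> 0"
      using tendsto_cong by fastforce
    then show ?thesis unfolding g_def by (rule tendsto_norm_zero)
  qed
  then have "\<forall>\<^sub>F n in sequentially. g n < 1/2" by (rule order_tendstoD) simp
  then obtain N where N: "\<And>n. n \<ge> N \<Longrightarrow> g n < 1/2" by (auto simp: eventually_sequentially)
  show "summable (\<lambda>n. fps_nth (kummer_fps a b) n * z ^ n)"
    unfolding f_def[symmetric]
  proof (rule summable_ratio_test[of "1/2" N])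
    show "norm (f (Suc n)) \<le> 1/2 * norm (f n)" if "n \<ge> N" for n
      unfolding f_Suc using N[OF that] by (intro mult_right_mono) auto
  qed simp
qed

lemma hyp1F1_eq_eval_fps: "hyp1F1 a b z = eval_fps (kummer_fps a b) z"
  by (simp add: hyp1F1_def eval_fps_def kummer_fps_def)


text \<open>
  Four contiguous relations of \<open>F = \<^sub>1F\<^sub>1\<close>, each checked on coefficients. They say that the derivatives of
  \<open>exp (- z) F(a; b; z)\<close>, \<open>F(a; b; z)\<close>, \<open>z\<^sup>b F(a; b + 1; z)\<close> and \<open>z\<^sup>b exp (- z) F(a; b + 1; z)\<close> are again
  functions of this kind, with one or both parameters shifted.
\<close>

context
  fixes b :: complex
  assumes b: "\<And>n. b + of_nat n \<noteq> 0"
begin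

lemma pochhammer_nz: "pochhammer b n \<noteq> 0"
  using b by (auto simp: pochhammer_eq_0_iff) (metis add.left_inverse)

lemma pochhammer_plus1: "pochhammer (b + 1) n = (b + of_nat n) * pochhammer b n / b"
  using b[of 0] pochhammer_rec[of b n] by (simp add: pochhammer_Suc field_simps)

lemma kummer_fps_deriv_raise_b:
  "fps_const b * (fps_deriv (kummer_fps a b) - kummer_fps a b) =
     fps_const (a - b) * kummer_fps a (b + 1)"
proof (rule fps_ext)
  fix n
  have b0: "b \<noteq> 0" "b + of_nat n \<noteq> 0" using b[of 0] b[of n] by auto
  show "fps_nth (fps_const b * (fps_deriv (kummer_fps a b) - kummer_fps a b)) n =
     fps_nth (fps_const (a - b) * kummer_fps a (b + 1)) n"
    using b0 pochhammer_nz[of n] unfolding kummer_fps_def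
    by (simp add: pochhammer_Suc pochhammer_plus1 divide_simps del: of_nat_Suc)
       (simp add: algebra_simps)
qed

lemma kummer_fps_deriv_raise_both:
  "fps_const b * fps_deriv (kummer_fps a b) = fps_const a * kummer_fps (a + 1) (b + 1)"
proof (rule fps_ext)
  fix n
  have b0: "b \<noteq> 0" "b + of_nat n \<noteq> 0" using b[of 0] b[of n] by auto
  show "fps_nth (fps_const b * fps_deriv (kummer_fps a b)) n =
     fps_nth (fps_const a * kummer_fps (a + 1) (b + 1)) n"
    using b0 pochhammer_nz[of n] unfolding kummer_fps_def
    by (simp add: pochhammer_Suc pochhammer_plus1 pochhammer_rec[of a n, symmetric] divide_simps del: of_nat_Suc)
qed

lemma kummer_fps_deriv_lower_b:
  "fps_const b * kummer_fps a (b + 1) + fps_X * fps_deriv (kummer_fps a (b + 1)) =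
     fps_const b * kummer_fps a b"
proof (rule fps_ext)
  fix n
  have b0: "b \<noteq> 0" "b + of_nat n \<noteq> 0" using b[of 0] b[of n] by auto
  have "fps_nth (fps_X * fps_deriv (kummer_fps a (b + 1))) n = of_nat n * fps_nth (kummer_fps a (b + 1)) n"
    by (cases n) auto
  then show "fps_nth (fps_const b * kummer_fps a (b + 1) + fps_X * fps_deriv (kummer_fps a (b + 1))) n =
     fps_nth (fps_const b * kummer_fps a b) n"
    using b0 pochhammer_nz[of n] unfolding kummer_fps_def
    by (simp add: pochhammer_plus1 divide_simps)
       (simp add: algebra_simps)
qed

lemma kummer_fps_deriv_lower_both:
  "fps_const b * kummer_fps a (b + 1) + fps_X * fps_deriv (kummer_fps a (b + 1))
     - fps_X * kummer_fps a (b + 1) = fps_const b * kummer_fps (a - 1) b"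
proof (rule fps_ext)
  fix n
  have b0: "b \<noteq> 0" using b[of 0] by auto
  show "fps_nth (fps_const b * kummer_fps a (b + 1) + fps_X * fps_deriv (kummer_fps a (b + 1))
     - fps_X * kummer_fps a (b + 1)) n = fps_nth (fps_const b * kummer_fps (a - 1) b) n"
  proof (cases n)
    case (Suc m)
    have 1: "pochhammer (a - 1) (Suc m) = (a - 1) * pochhammer a m"
      by (simp add: pochhammer_rec)
    have 2: "pochhammer b (Suc m) = (b + of_nat m) * pochhammer b m"
      by (simp add: pochhammer_Suc)
    have nz: "b + of_nat m \<noteq> 0" "b + (1 + of_nat m) \<noteq> 0" "1 + of_nat m \<noteq> (0 :: complex)"
      using b[of m] b[of "Suc m"] of_nat_neq_0[of m, where ?'a = complex] by (auto simp: add_ac)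
    show ?thesis
      using b0 nz pochhammer_nz[of m] unfolding kummer_fps_def Suc
      by (simp add: pochhammer_plus1 1 2 pochhammer_Suc[of a] divide_simps)
         (simp add: algebra_simps)
  qed (simp add: kummer_fps_def)
qed

end

lemma half_plus_nat_nz: "1/2 + of_nat n \<noteq> (0 :: complex)" "3/2 + of_nat n \<noteq> (0 :: complex)"
  by (auto simp: complex_eq_iff)

section \<open>Parabolic cylinder functions\<close>

text \<open>
  Up to constants, the even and the odd part of \<open>exp (z\<^sup>2/4) D(z)\<close>. The substitution \<open>z\<^sup>2/2\<close> turns each
  of the contiguous relations into a first-order relation between an even and an odd function. These
  relations are named \<open>raise\<close> or \<open>lower\<close> after the effect that they have on the index of \<open>D\<close>; the former
  involve the derivative minus \<open>z\<close> times the function, the latter the derivative alone.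
\<close>

definition kummer_even :: "complex \<Rightarrow> complex \<Rightarrow> complex" where
  "kummer_even a z = hyp1F1 a (1/2) (z\<^sup>2 / 2)"

definition kummer_odd :: "complex \<Rightarrow> complex \<Rightarrow> complex" where
  "kummer_odd a z = z * hyp1F1 a (3/2) (z\<^sup>2 / 2)"

lemma fps_conv_radius_kummer_half [simp]:
  "fps_conv_radius (kummer_fps a (1/2)) = \<infinity>" "fps_conv_radius (kummer_fps a (3/2)) = \<infinity>"
  using half_plus_nat_nz by simp_all

lemma fps_conv_radius_deriv_kummer_half [simp]:
  "fps_conv_radius (fps_deriv (kummer_fps a (1/2))) = \<infinity>"
  "fps_conv_radius (fps_deriv (kummer_fps a (3/2))) = \<infinity>"
  using fps_conv_radius_deriv[of "kummer_fps a (1/2)"] fps_conv_radius_deriv[of "kummer_fps a (3/2)"]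
  by simp_all

lemma kummer_even_has_field_derivative:
  "(kummer_even a has_field_derivative z * eval_fps (fps_deriv (kummer_fps a (1/2))) (z\<^sup>2 / 2)) (at z)"
  unfolding kummer_even_def hyp1F1_eq_eval_fps
  by (rule has_field_derivative_eval_fps' derivative_eq_intros refl | simp)+

lemma kummer_odd_has_field_derivative:
  "(kummer_odd a has_field_derivative hyp1F1 a (3/2) (z\<^sup>2 / 2) +
      z\<^sup>2 * eval_fps (fps_deriv (kummer_fps a (3/2))) (z\<^sup>2 / 2)) (at z)"
  unfolding kummer_odd_def hyp1F1_eq_eval_fps
  by (rule has_field_derivative_eval_fps' derivative_eq_intros refl | simp)+ 
     (simp add: power2_eq_square)

lemma kummer_even_deriv_raise:
  "(kummer_even a has_field_derivative z * kummer_even a z + (2 * a - 1) * kummer_odd a z) (at z)"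
proof -
  define s where "s = z\<^sup>2 / 2"
  have "eval_fps (fps_const (1/2) * (fps_deriv (kummer_fps a (1/2)) - kummer_fps a (1/2))) s =
        eval_fps (fps_const (a - 1/2) * kummer_fps a (1/2 + 1)) s"
    using kummer_fps_deriv_raise_b[OF half_plus_nat_nz(1), of a] by (rule arg_cong)
  then have "1/2 * (eval_fps (fps_deriv (kummer_fps a (1/2))) s - eval_fps (kummer_fps a (1/2)) s) =
      (a - 1/2) * eval_fps (kummer_fps a (3/2)) s"
    using fps_conv_radius_diff[of "fps_deriv (kummer_fps a (1/2))" "kummer_fps a (1/2)"]
    by (simp add: eval_fps_mult eval_fps_diff)
  then have "eval_fps (fps_deriv (kummer_fps a (1/2))) s =
      hyp1F1 a (1/2) s + (2 * a - 1) * hyp1F1 a (3/2) s"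
    unfolding hyp1F1_eq_eval_fps by (drule_tac arg_cong[of _ _ "\<lambda>x. 2 * x"]) (simp add: algebra_simps)
  note deriv = kummer_even_has_field_derivative[of a z, folded s_def, unfolded this]
  show ?thesis
    using deriv by (simp add: kummer_even_def kummer_odd_def algebra_simps flip: s_def)
qed

lemma kummer_even_deriv_lower:
  "(kummer_even a has_field_derivative 2 * a * kummer_odd (a + 1) z) (at z)"
proof -
  define s where "s = z\<^sup>2 / 2"
  have "eval_fps (fps_const (1/2) * fps_deriv (kummer_fps a (1/2))) s =
        eval_fps (fps_const a * kummer_fps (a + 1) (1/2 + 1)) s"
    using kummer_fps_deriv_raise_both[OF half_plus_nat_nz(1), of a] by (rule arg_cong)
  then have "eval_fps (fps_deriv (kummer_fps a (1/2))) s = 2 * a * hyp1F1 (a + 1) (3/2) s"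
    by (simp add: eval_fps_mult hyp1F1_eq_eval_fps field_simps)
  then show ?thesis
    using kummer_even_has_field_derivative[of a z]
    by (simp add: kummer_odd_def s_def algebra_simps)
qed

lemma kummer_odd_deriv_lower:
  "(kummer_odd a has_field_derivative kummer_even a z) (at z)"
proof -
  define s where "s = z\<^sup>2 / 2"
  have "eval_fps (fps_const (1/2) * kummer_fps a (1/2 + 1) + fps_X * fps_deriv (kummer_fps a (1/2 + 1))) s =
     eval_fps (fps_const (1/2) * kummer_fps a (1/2)) s"
    using kummer_fps_deriv_lower_b[OF half_plus_nat_nz(1), of a] by (rule arg_cong)
  then have "1/2 * hyp1F1 a (3/2) s + s * eval_fps (fps_deriv (kummer_fps a (3/2))) s =
      1/2 * hyp1F1 a (1/2) s"
    using fps_conv_radius_mult[of "fps_const (1/2)" "kummer_fps a (3/2)"]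
      fps_conv_radius_mult[of fps_X "fps_deriv (kummer_fps a (3/2))"]
    by (simp add: eval_fps_mult eval_fps_add hyp1F1_eq_eval_fps)
  then show ?thesis
    using kummer_odd_has_field_derivative[of a z]
    by (simp add: kummer_even_def s_def algebra_simps)
qed

lemma kummer_odd_deriv_raise:
  "(kummer_odd a has_field_derivative z * kummer_odd a z + kummer_even (a - 1) z) (at z)"
proof -
  define s where "s = z\<^sup>2 / 2"
  have "eval_fps (fps_const (1/2) * kummer_fps a (1/2 + 1) + fps_X * fps_deriv (kummer_fps a (1/2 + 1))
      - fps_X * kummer_fps a (1/2 + 1)) s =
     eval_fps (fps_const (1/2) * kummer_fps (a - 1) (1/2)) s"
    using kummer_fps_deriv_lower_both[OF half_plus_nat_nz(1), of a] by (rule arg_cong)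
  then have "1/2 * hyp1F1 a (3/2) s + s * eval_fps (fps_deriv (kummer_fps a (3/2))) s
        - s * hyp1F1 a (3/2) s = 1/2 * hyp1F1 (a - 1) (1/2) s"
    using fps_conv_radius_mult[of "fps_const (1/2)" "kummer_fps a (3/2)"]
      fps_conv_radius_mult[of fps_X "fps_deriv (kummer_fps a (3/2))"]
      fps_conv_radius_mult[of fps_X "kummer_fps a (3/2)"]
      fps_conv_radius_add[of "fps_const (1/2) * kummer_fps a (3/2)" "fps_X * fps_deriv (kummer_fps a (3/2))"]
    by (simp add: eval_fps_mult eval_fps_add eval_fps_diff hyp1F1_eq_eval_fps)
  then show ?thesis
    using kummer_odd_has_field_derivative[of a z]
    by (simp add: kummer_even_def kummer_odd_def s_def algebra_simps power2_eq_square)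
qed

definition parcyl_const :: "complex \<Rightarrow> complex" where
  "parcyl_const a = 2 powr (a / 2) * of_real (sqrt pi)"

definition sqrt2 :: complex where "sqrt2 = of_real (sqrt 2)"

lemma sqrt2_sq [simp]: "sqrt2 * sqrt2 = 2"
  unfolding sqrt2_def of_real_mult[symmetric] by simp

lemma sqrt2_sq_left [simp]: "sqrt2 * (sqrt2 * c) = 2 * c"
  by (simp flip: mult.assoc)

lemma parcyl_const_plus1: "parcyl_const (a + 1) = sqrt2 * parcyl_const a"
proof -
  have "(2::complex) powr ((a + 1) / 2) = 2 powr (a / 2) * 2 powr (1/2)"
    by (simp add: powr_add[symmetric] add_divide_distrib)
  also have "(2::complex) powr (1/2) = sqrt2"
    using powr_Reals_eq[of 2 "1/2"] by (simp add: sqrt2_def powr_half_sqrt[symmetric])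
  finally show ?thesis by (simp add: parcyl_const_def)
qed

lemma parcyl_eq: "parcyl a z = parcyl_const a * exp (- (z\<^sup>2) / 4) *
     (rGamma ((1 - a) / 2) * kummer_even (- a / 2) z
       - sqrt2 * rGamma (- a / 2) * kummer_odd ((1 - a) / 2) z)"
  by (simp add: parcyl_def parcyl_const_def sqrt2_def kummer_even_def kummer_odd_def mult_ac)

text \<open>
  The recurrence of \<open>1/\<Gamma>\<close> brings \<open>D\<^sub>a\<^sub>+\<^sub>1\<close> to the Gamma factors of \<open>D\<^sub>a\<close>, so that the two can be
  compared termwise.
\<close>

lemma parcyl_plus1_eq: "parcyl (a + 1) z = parcyl_const a * exp (- (z\<^sup>2) / 4) *
     (sqrt2 * rGamma (- a / 2) * kummer_even (- (a + 1) / 2) z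
       + (a + 1) * rGamma ((1 - a) / 2) * kummer_odd (- a / 2) z)"
proof -
  have e: "rGamma (- (a + 1) / 2) = - (a + 1) / 2 * rGamma ((1 - a) / 2)"
    using rGamma_plus1[of "- (a + 1) / 2"] by (simp add: field_simps)
  have i: "(1 - (a + 1)) / 2 = - a / 2" by simp
  have "parcyl (a + 1) z = sqrt2 * parcyl_const a * exp (- (z\<^sup>2) / 4) *
     (rGamma (- a / 2) * kummer_even (- (a + 1) / 2) z
       - sqrt2 * (- (a + 1) / 2 * rGamma ((1 - a) / 2)) * kummer_odd (- a / 2) z)"
    by (simp only: parcyl_eq[of "a + 1"] parcyl_const_plus1 e i)
  moreover have "sqrt2 * C * E * (R * U - sqrt2 * (- (a + 1) / 2 * R') * V)
      = C * E * (sqrt2 * R * U + (a + 1) * R' * V)" for C E R R' U V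
    by (simp add: field_simps)
  ultimately show ?thesis by (simp only:)
qed

lemma exp_quarter_square_deriv:
  "((\<lambda>z::complex. exp (- (z\<^sup>2) / 4)) has_field_derivative - (z / 2) * exp (- (z\<^sup>2) / 4)) (at z)"
  by (rule derivative_eq_intros refl | simp)+

text \<open>
  The factor \<open>exp (- z\<^sup>2/4)\<close> contributes \<open>- z/2\<close> to the logarithmic derivative. Depending on whether the
  even and odd functions are differentiated by their \<open>raise\<close> or their \<open>lower\<close> relations, the total is
  \<open>z/2\<close> or \<open>- z/2\<close>, and the remaining terms form the neighbouring \<open>D\<close>.
\<close>

lemma parcyl_deriv_raise:
  "(parcyl a has_field_derivative z / 2 * parcyl a z - parcyl (a + 1) z) (at z)"
proof -
  have p: "parcyl a = (\<lambda>z. parcyl_const a * exp (- (z\<^sup>2) / 4) *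
     (rGamma ((1 - a) / 2) * kummer_even (- a / 2) z
       - sqrt2 * rGamma (- a / 2) * kummer_odd ((1 - a) / 2) z))"
    by (rule ext) (rule parcyl_eq)
  have "(1 - a) / 2 - 1 = - (a + 1) / 2" by (simp add: field_simps)
  note dodd = kummer_odd_deriv_raise[of "(1 - a) / 2" z, unfolded this]
  show ?thesis
    unfolding parcyl_plus1_eq unfolding p
    by (rule exp_quarter_square_deriv kummer_even_deriv_raise dodd derivative_eq_intros refl)+
       (simp add: algebra_simps)
qed

lemma parcyl_deriv_lower:
  "(parcyl (a + 1) has_field_derivative (a + 1) * parcyl a z - z / 2 * parcyl (a + 1) z) (at z)"
proof -
  have p: "parcyl (a + 1) = (\<lambda>z. parcyl_const a * exp (- (z\<^sup>2) / 4) *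
     (sqrt2 * rGamma (- a / 2) * kummer_even (- (a + 1) / 2) z
       + (a + 1) * rGamma ((1 - a) / 2) * kummer_odd (- a / 2) z))"
    by (rule ext) (rule parcyl_plus1_eq)
  have "- (a + 1) / 2 + 1 = (1 - a) / 2" "2 * (- (a + 1) / 2) = - (a + 1)"
    by (simp_all add: field_simps)
  note deven = kummer_even_deriv_lower[of "- (a + 1) / 2" z, unfolded this]
  show ?thesis
    unfolding parcyl_eq[of a] unfolding p
    by (rule exp_quarter_square_deriv deven kummer_odd_deriv_lower derivative_eq_intros refl)+
       (simp add: algebra_simps add_divide_distrib)
qed

lemma parcyl_minus_deriv:
  "(parcyl (- a) has_field_derivative (- a) * parcyl (- a - 1) z - z / 2 * parcyl (- a) z) (at z)"
  using parcyl_deriv_lower[of "- a - 1" z] by simp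

lemma parcyl_minus_minus1_deriv:
  "(parcyl (- a - 1) has_field_derivative z / 2 * parcyl (- a - 1) z - parcyl (- a) z) (at z)"
  using parcyl_deriv_raise[of "- a - 1" z] by simp

lemma parcyl_0: "parcyl a 0 = parcyl_const a * rGamma ((1 - a) / 2)"
  by (simp add: parcyl_eq kummer_even_def kummer_odd_def hyp1F1_eq_eval_fps eval_fps_at_0 kummer_fps_def)

lemma parcyl_const_minus: "parcyl_const a * parcyl_const (- a) = of_real pi"
proof -
  have "(2::complex) powr (a / 2) * 2 powr (- a / 2) = 1"
    by (simp add: powr_add[symmetric])
  moreover have "complex_of_real (sqrt pi) * of_real (sqrt pi) = of_real pi"
    unfolding of_real_mult[symmetric] by simp
  ultimately show ?thesis
    unfolding parcyl_const_def by (metis (no_types, lifting) mult.assoc mult.commute mult.right_neutral)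
qed

text \<open>
  The left-hand side is minus the Wronskian of \<open>D\<^sub>a(z)\<close> and \<open>D\<^sub>-\<^sub>a\<^sub>-\<^sub>1(\<i>z)\<close>, with the derivatives
  replaced by means of the ladder relations. Its derivative vanishes, and at \<open>z = 0\<close> only Gamma values
  remain: the powers of two cancel, and the reflection formula turns the rest into \<open>\<i> cos (\<pi>a/2) + sin (\<pi>a/2)\<close>.
\<close>

lemma parcyl_wronskian:
  "z * parcyl a z * parcyl (- a - 1) (\<i> * z) + \<i> * parcyl a z * parcyl (- a) (\<i> * z)
     - parcyl (a + 1) z * parcyl (- a - 1) (\<i> * z) = \<i> * exp (- \<i> * of_real pi * a / 2)"
proof -
  define W where "W = (\<lambda>z. z * parcyl a z * parcyl (- a - 1) (\<i> * z)
     + \<i> * parcyl a z * parcyl (- a) (\<i> * z) - parcyl (a + 1) z * parcyl (- a - 1) (\<i> * z))"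
  have "(W has_field_derivative 0) (at z)" for z
    unfolding W_def
    by (rule derivative_eq_intros parcyl_deriv_raise parcyl_deriv_lower
          DERIV_chain2[OF parcyl_minus_deriv] DERIV_chain2[OF parcyl_minus_minus1_deriv] refl)+
       (simp add: algebra_simps)
  then obtain c where "\<And>z. W z = c"
    using has_field_derivative_zero_constant[of UNIV W] by auto
  then have "W z = W 0" by simp
  also have "\<dots> = \<i> * (parcyl_const a * parcyl_const (- a)) * (rGamma ((1 - a) / 2) * rGamma (1 - (1 - a) / 2))
      - (parcyl_const (a + 1) * parcyl_const (- (a + 1))) * (rGamma (- a / 2) * rGamma (1 - (- a / 2)))"
  proof -
    have "(1 - - a) / 2 = 1 - (1 - a) / 2" "(1 - (a + 1)) / 2 = - a / 2"
        "(1 - (- a - 1)) / 2 = 1 - (- a / 2)" "- (a + 1) = - a - 1" by (simp_all add: field_simps)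
    then show ?thesis unfolding W_def
      by (simp only: parcyl_0 mult_zero_right mult_zero_left add_0) (simp add: mult_ac)
  qed
  also have "\<dots> = \<i> * cos (of_real pi * a / 2) + sin (of_real pi * a / 2)"
  proof -
    have "sin (of_real pi * ((1 - a) / 2)) = cos (of_real pi * a / 2)"
      by (simp add: cos_sin_eq algebra_simps diff_divide_distrib)
    then show ?thesis
      unfolding parcyl_const_minus rGamma_reflection_complex by simp
  qed
  also have "\<dots> = \<i> * exp (- \<i> * of_real pi * a / 2)"
  proof -
    define t where "t = of_real pi * a / 2"
    have e: "exp (- (\<i> * t)) = cos t - \<i> * sin t" using exp_Euler[of "- t"] by simp
    have "- \<i> * of_real pi * a / 2 = - (\<i> * t)" by (simp add: t_def)
    then show ?thesis by (simp only: e flip: t_def) (simp add: algebra_simps)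
  qed
  finally show ?thesis by (simp add: W_def)
qed

section \<open>The Riccati equation for quotients of cylinder functions\<close>

text \<open>
  The general solution of Weber's equation with index \<open>\<nu>\<close>, \<open>D'' + (\<nu> + 1/2 - X\<^sup>2/4) D = 0\<close>.
\<close>

definition cylinder :: "complex \<Rightarrow> complex \<Rightarrow> complex \<Rightarrow> complex \<Rightarrow> complex" where
  "cylinder \<nu> A B X = A * parcyl \<nu> X + B * parcyl (- \<nu> - 1) (\<i> * X)"

text \<open>
  The function \<open>(X/2) D - D'\<close> for \<open>D\<close> the solution above, that is \<open>- exp (X\<^sup>2/4) (exp (- X\<^sup>2/4) D)'\<close>. On the
  first solution it raises the index by one; on the second one the inner derivative \<open>\<i>\<close> leaves the
  additional term with the factor \<open>X\<close>.
\<close>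

definition cylinder_raise :: "complex \<Rightarrow> complex \<Rightarrow> complex \<Rightarrow> complex \<Rightarrow> complex" where
  "cylinder_raise \<nu> A B X = A * parcyl (\<nu> + 1) X
     + B * (X * parcyl (- \<nu> - 1) (\<i> * X) + \<i> * parcyl (- \<nu>) (\<i> * X))"

lemma cylinder_deriv:
  "(cylinder \<nu> A B has_field_derivative X / 2 * cylinder \<nu> A B X - cylinder_raise \<nu> A B X) (at X)"
  unfolding cylinder_def cylinder_raise_def
  by (rule derivative_eq_intros parcyl_deriv_raise
        DERIV_chain2[OF parcyl_minus_minus1_deriv] refl)+
     (simp add: algebra_simps)

lemma cylinder_raise_deriv:
  "(cylinder_raise \<nu> A B has_field_derivative
      (\<nu> + 1) * cylinder \<nu> A B X - X / 2 * cylinder_raise \<nu> A B X) (at X)"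
  unfolding cylinder_def cylinder_raise_def
  by (rule derivative_eq_intros parcyl_deriv_lower DERIV_chain2[OF parcyl_minus_deriv]
        DERIV_chain2[OF parcyl_minus_minus1_deriv] refl)+
     (simp add: algebra_simps)

text \<open>
  The quotient is \<open>-\<phi>'/\<phi>\<close> for \<open>\<phi>(t) = exp (- X\<^sup>2/4) D(X)\<close>, \<open>D\<close> a solution of Weber's equation.
\<close>

lemma cylinder_quotient_deriv:
  fixes \<nu> A B \<delta> X0 t :: complex
  defines "X \<equiv> \<lambda>t. \<delta> * t + X0"
  defines "g \<equiv> \<lambda>t. \<delta> * cylinder_raise \<nu> A B (X t) / cylinder \<nu> A B (X t)"
  assumes "cylinder \<nu> A B (X t) \<noteq> 0"
  shows "(g has_field_derivative (g t)\<^sup>2 - \<delta> * X t * g t + \<delta>\<^sup>2 * (\<nu> + 1)) (at t)"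
  unfolding g_def
proof (rule DERIV_cong, rule DERIV_divide)
  have X: "(X has_field_derivative \<delta>) (at t)"
    unfolding X_def by (rule derivative_eq_intros refl | simp)+
  show "((\<lambda>t. \<delta> * cylinder_raise \<nu> A B (X t)) has_field_derivative
      \<delta> * (((\<nu> + 1) * cylinder \<nu> A B (X t) - X t / 2 * cylinder_raise \<nu> A B (X t)) * \<delta>)) (at t)"
    by (intro DERIV_cmult DERIV_chain2[OF cylinder_raise_deriv X])
  show "((\<lambda>t. cylinder \<nu> A B (X t)) has_field_derivative
      (X t / 2 * cylinder \<nu> A B (X t) - cylinder_raise \<nu> A B (X t)) * \<delta>) (at t)"
    by (rule DERIV_chain2[OF cylinder_deriv X])
qed (use assms(3) in \<open>simp_all add: field_simps power2_eq_square\<close>)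

text \<open>
  The coefficient of \<open>t\<^sup>m\<close> on the right involves the unknown series only up to degree \<open>m\<close>, while on the left it
  is \<open>m + 1\<close> times the coefficient of degree \<open>m + 1\<close>.
\<close>

lemma riccati_fps_unique:
  fixes F G H K :: "'a :: field_char_0 fps"
  assumes F: "fps_deriv F = F * (F + H) + K" and G: "fps_deriv G = G * (G + H) + K"
    and init: "fps_nth F 0 = fps_nth G 0"
  shows "F = G"
proof (rule fps_ext)
  fix n show "fps_nth F n = fps_nth G n"
  proof (induction n rule: less_induct)
    case (less n)
    show ?case
    proof (cases n)
      case (Suc m)
      have "fps_nth (F * (F + H) + K) m = fps_nth (G * (G + H) + K) m"
        using less.IH Suc by (simp add: fps_mult_nth)
      then have "of_nat (Suc m) * fps_nth F (Suc m) = of_nat (Suc m) * fps_nth G (Suc m)"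
        by (simp flip: F G)
      then show ?thesis using Suc by (simp del: of_nat_Suc)
    qed (simp add: init)
  qed
qed

text \<open>
  An analytic solution near \<open>0\<close> has a Taylor series that solves the same equation formally.
\<close>

lemma riccati_has_fps_expansion:
  fixes g :: "complex \<Rightarrow> complex" and F :: "complex fps"
  assumes ode: "\<forall>\<^sub>F t in nhds 0. (g has_field_derivative g t * (g t + (c - d * t)) + k) (at t)"
    and F: "fps_deriv F = F * (F + (fps_const c - fps_const d * fps_X)) + fps_const k"
    and init: "g 0 = fps_nth F 0"
  shows "g has_fps_expansion F"
proof -
  obtain S where S: "open S" "0 \<in> S"
    "\<And>t. t \<in> S \<Longrightarrow> (g has_field_derivative g t * (g t + (c - d * t)) + k) (at t)"
    using ode by (auto simp: eventually_nhds)
  have "g holomorphic_on S"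
    using S(1,3) by (metis field_differentiable_def holomorphic_onI field_differentiable_at_within)
  then have "g analytic_on {0}"
    using S(1,2) analytic_at by blast
  then obtain G where G: "g has_fps_expansion G"
    using analytic_at_imp_has_fps_expansion_0 by blast
  have "(\<lambda>t. g t * (g t + (c - d * t)) + k) has_fps_expansion
      G * (G + (fps_const c - fps_const d * fps_X)) + fps_const k"
    by (intro fps_expansion_intros G)
  moreover have "\<forall>\<^sub>F t in nhds 0. deriv g t = g t * (g t + (c - d * t)) + k"
    using ode by eventually_elim (rule DERIV_imp_deriv)
  ultimately have "deriv g has_fps_expansion
      G * (G + (fps_const c - fps_const d * fps_X)) + fps_const k"
    by (subst has_fps_expansion_cong[OF _ refl])
  then have "fps_deriv G = G * (G + (fps_const c - fps_const d * fps_X)) + fps_const k"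
    using has_fps_expansion_deriv[OF G] fps_expansion_unique_complex by blast
  moreover have "fps_nth G 0 = fps_nth F 0"
    using init has_fps_expansion_imp_0_eq_fps_nth_0[OF G] by simp
  ultimately have "G = F"
    using F riccati_fps_unique by blast
  then show ?thesis using G by simp
qed

section \<open>The generating function\<close>

theorem theorem1p9:
  fixes x y z w u v \<delta> \<delta>' p q r s :: complex
  assumes "x * v \<noteq> z * u"
    and "\<delta> ^ 2 = x * v - z * u"
    and "\<delta>' ^ 2 = z * u - x * v"
    and "\<delta>' = \<i> * \<delta>"
    and "p = parcyl ((z * u - y * w) / \<delta> ^ 2) ((w - y) / \<delta>)"
    and "q = parcyl ((x * v - y * w) / \<delta>' ^ 2) ((y - w) / \<delta>')"
    and "r = parcyl ((x * v - y * w) / \<delta> ^ 2) ((w - y) / \<delta>)"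
    and "s = parcyl ((z * u - y * w) / \<delta>' ^ 2) ((y - w) / \<delta>')"
  shows "(\<lambda>t.
      ((\<delta> ^ 2 * t + w - y) * (p * w - \<delta> * r)
         * parcyl ((x * v - y * w) / \<delta>' ^ 2) (\<delta>' * t + (y - w) / \<delta>'))
      / ((\<delta>' * s - q * y) * parcyl ((z * u - y * w) / \<delta> ^ 2) (\<delta> * t + (w - y) / \<delta>)
         + (p * w - \<delta> * r) * parcyl ((x * v - y * w) / \<delta>' ^ 2) (\<delta>' * t + (y - w) / \<delta>'))
    + (\<delta> * (\<delta>' * s - q * y) * parcyl ((x * v - y * w) / \<delta> ^ 2) (\<delta> * t + (w - y) / \<delta>)
         + \<delta>' * (p * w - \<delta> * r) * parcyl ((z * u - y * w) / \<delta>' ^ 2) (\<delta>' * t + (y - w) / \<delta>'))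
      / ((\<delta>' * s - q * y) * parcyl ((z * u - y * w) / \<delta> ^ 2) (\<delta> * t + (w - y) / \<delta>)
         + (p * w - \<delta> * r) * parcyl ((x * v - y * w) / \<delta>' ^ 2) (\<delta>' * t + (y - w) / \<delta>')))
    has_fps_expansion Abs_fps (\<lambda>n. Q n x y z w u v / fact n)"
proof -
  define \<nu> where "\<nu> = (z * u - y * w) / \<delta>\<^sup>2"
  define X0 where "X0 = (w - y) / \<delta>"
  define A where "A = \<delta>' * s - q * y"
  define B where "B = p * w - \<delta> * r"
  have \<delta>: "\<delta> \<noteq> 0" using assms(1,2) by auto
  have d2: "\<delta>'\<^sup>2 = - \<delta>\<^sup>2" using assms(2,3) by simp
  have zuyw: "z * u - y * w = \<delta>\<^sup>2 * \<nu>" using \<delta> by (simp add: \<nu>_def)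
  have "x * v - y * w = (z * u - y * w) + \<delta>\<^sup>2" using assms(2) by simp
  then have k: "x * v - y * w = \<delta>\<^sup>2 * (\<nu> + 1)"
    unfolding zuyw by (simp add: distrib_left)
  have wy: "w - y = \<delta> * X0" using \<delta> by (simp add: X0_def)
  have idx: "(x * v - y * w) / \<delta>'\<^sup>2 = - \<nu> - 1" "(x * v - y * w) / \<delta>\<^sup>2 = \<nu> + 1"
    "(z * u - y * w) / \<delta>'\<^sup>2 = - \<nu>"
    unfolding k zuyw d2 using \<delta> by (simp_all add: field_simps)
  have arg0: "(y - w) / \<delta>' = \<i> * X0"
    using \<delta> unfolding assms(4) X0_def by (simp add: field_simps)
  have arg: "\<delta>' * t + \<i> * X0 = \<i> * (\<delta> * t + X0)" for t
    by (simp add: assms(4) algebra_simps)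
  have pqrs: "p = parcyl \<nu> X0" "q = parcyl (- \<nu> - 1) (\<i> * X0)"
    "r = parcyl (\<nu> + 1) X0" "s = parcyl (- \<nu>) (\<i> * X0)"
    unfolding assms(5-8) idx arg0 by (simp_all add: \<nu>_def X0_def)
  define g where "g = (\<lambda>t. \<delta> * cylinder_raise \<nu> A B (\<delta> * t + X0) / cylinder \<nu> A B (\<delta> * t + X0))"

  (* With the coefficients A and B the denominator at t = 0 is a multiple of the Wronskian. *)
  have den0: "cylinder \<nu> A B X0 \<noteq> 0"
  proof -
    have "cylinder \<nu> A B X0 = \<delta> * (X0 * p * q + \<i> * p * s - r * q)"
    proof -
      have "cylinder \<nu> A B X0 = (\<i> * \<delta> * s - q * y) * p + (p * w - \<delta> * r) * q"
        by (simp add: cylinder_def A_def B_def assms(4) flip: pqrs)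
      also have "\<dots> = \<i> * \<delta> * s * p + (w - y) * p * q - \<delta> * r * q"
        by (simp add: algebra_simps)
      finally show ?thesis unfolding wy by (simp add: algebra_simps)
    qed
    also have "\<dots> = \<delta> * (\<i> * exp (- \<i> * of_real pi * \<nu> / 2))"
      unfolding pqrs parcyl_wronskian ..
    finally show ?thesis using \<delta> by simp
  qed
  (* The residual of the initial condition is B for the first solution and -A for the second, so the
     combination with coefficients A and B satisfies it. *)
  have "g 0 = w"
  proof -
    have "\<delta> * cylinder_raise \<nu> A B X0 = \<delta> * r * A + B * ((\<delta> * X0) * q + \<delta>' * s)"
      unfolding cylinder_raise_def assms(4) pqrs[symmetric] by (simp add: algebra_simps)
    also have "\<dots> = w * (A * p + B * q)"
      unfolding wy[symmetric] A_def B_def by (simp add: algebra_simps)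
    also have "A * p + B * q = cylinder \<nu> A B X0"
      by (simp add: cylinder_def flip: pqrs)
    finally show ?thesis using den0 by (simp add: g_def)
  qed

  have "g has_fps_expansion perm_egf (x * v) (z * u) w y"
  proof (rule riccati_has_fps_expansion)
    have "((\<lambda>t. \<delta> * t + X0) has_field_derivative \<delta>) (at 0)"
      by (rule derivative_eq_intros refl | simp)+
    then have "isCont (\<lambda>t. cylinder \<nu> A B (\<delta> * t + X0)) 0"
      using DERIV_isCont DERIV_chain2[OF cylinder_deriv] by blast
    then have "\<forall>\<^sub>F t in at 0. cylinder \<nu> A B (\<delta> * t + X0) \<noteq> 0"
      using den0 by (intro tendsto_imp_eventually_ne[where c = "cylinder \<nu> A B X0"])
        (simp_all add: isCont_def)
    then have "\<forall>\<^sub>F t in nhds 0. cylinder \<nu> A B (\<delta> * t + X0) \<noteq> 0"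
      using den0 by (simp add: eventually_nhds_conv_at)
    then show "\<forall>\<^sub>F t in nhds 0. (g has_field_derivative
        g t * (g t + ((y - w) - (x * v - z * u) * t)) + (x * v - y * w)) (at t)"
    proof eventually_elim
      case (elim t)
      have "(g has_field_derivative (g t)\<^sup>2 - \<delta> * (\<delta> * t + X0) * g t + \<delta>\<^sup>2 * (\<nu> + 1)) (at t)"
        unfolding g_def by (rule cylinder_quotient_deriv[OF elim])
      moreover have "\<delta> * (\<delta> * t + X0) = \<delta>\<^sup>2 * t + \<delta> * X0"
        by (simp add: algebra_simps power2_eq_square)
      then have X: "\<delta> * (\<delta> * t + X0) = - ((y - w) - (x * v - z * u) * t)"
        unfolding assms(2) wy[symmetric] by simp
      have "(g t)\<^sup>2 - \<delta> * (\<delta> * t + X0) * g t + \<delta>\<^sup>2 * (\<nu> + 1) =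
          g t * (g t + ((y - w) - (x * v - z * u) * t)) + (x * v - y * w)"
        unfolding X k by (simp add: algebra_simps power2_eq_square)
      ultimately show ?case by (simp only:)
    qed
    show "fps_deriv (perm_egf (x * v) (z * u) w y) = perm_egf (x * v) (z * u) w y *
        (perm_egf (x * v) (z * u) w y + (fps_const (y - w) - fps_const (x * v - z * u) * fps_X))
        + fps_const (x * v - y * w)"
      using perm_egf_riccati[of "x * v" "z * u" w y] by (simp add: add_diff_eq)
    show "g 0 = fps_nth (perm_egf (x * v) (z * u) w y) 0"
      by (simp add: \<open>g 0 = w\<close> perm_egf_def perm_sum_def)
  qed
  also have "perm_egf (x * v) (z * u) w y = Abs_fps (\<lambda>n. Q n x y z w u v / fact n)"
    by (simp add: perm_egf_def Q_eq_perm_sum)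
  finally have expansion: "g has_fps_expansion Abs_fps (\<lambda>n. Q n x y z w u v / fact n)" .
  (* The right-hand side of the theorem is g, split into two fractions. *)
  have T: "\<delta>\<^sup>2 * t + w - y = \<delta> * (\<delta> * t + X0)" for t
    using wy by (simp add: algebra_simps power2_eq_square)
  have "(\<lambda>t. \<delta> * (\<delta> * t + X0) * B * parcyl (- \<nu> - 1) (\<i> * (\<delta> * t + X0)) / cylinder \<nu> A B (\<delta> * t + X0)
     + (\<delta> * A * parcyl (\<nu> + 1) (\<delta> * t + X0) + \<delta>' * B * parcyl (- \<nu>) (\<i> * (\<delta> * t + X0)))
        / cylinder \<nu> A B (\<delta> * t + X0)) = g"
    unfolding g_def cylinder_raise_def assms(4)
    by (simp add: algebra_simps flip: add_divide_distrib)
  then show ?thesis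
    using expansion unfolding idx arg0 arg T \<nu>_def[symmetric] X0_def[symmetric]
      A_def[symmetric] B_def[symmetric] cylinder_def by simp
qed

end
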